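(* For every variable $x\in V$, every command $c\in\mathcal C$ and every reflexive relation $g\subseteq\Sigma\times\Sigma$, $$(\mathbf{var}\,x\cdot c\Cap\mathbf{guar}\,g)\;=\;(\mathbf{var}\,x\cdot c\Cap\mathbf{guar}\,g)\Cap\mathbf{guar}\big((\mathsf E_x g)\cap\mathrm{id}(x)\big).$$
   Context: Commands. $(\mathcal C,\le,\bigwedge,\bigsqcup,\bot,\top)$ is a complete distributive lattice (with arbitrary meet $\bigwedge$, binary meet $\sqcap$, arbitrary join $\bigsqcup$ and binary join $\sqcup$) whose elements are called commands. It has an associative sequential composition $;$ with identity $\mathbf{nil}$, monotone in both arguments, and an associative, commutative, idempotent, monotone weak conjunction $\Cap$. Iterations: $c^0=\mathbf{nil}$, $c^{i+1}=c;c^i$; $c^\star$ (resp. $c^\omega$) is the least (resp. greatest) fixed point of $y\mapsto\mathbf{nil}\sqcup c;y$; $c^\infty=c^\omega;\bot$. One has $c^\star=\bigsqcup_{i\in\mathbb N}c^i$ and $c^\omega=c^\star\sqcup c^\infty$. States and relations. $V$ is a countable set of variables, $S$ a set, $\Sigma$ the set of partial functions $V\rightharpoonup S$. For $W\subseteq V$, $\mathrm{id}(W)$ relates $\sigma,\sigma'\in\Sigma$ iff they agree on every variable in $W$; $\mathrm{id}(x)=\mathrm{id}(\{x\})$, $\mathrm{id}(\overline x)=\mathrm{id}(V\setminus\{x\})$, and $\mathrm{id}$ is the identity relation on $\Sigma$. For $p\subseteq\Sigma$, $\mathsf E_x p$ is the image of $p$ under $\mathrm{id}(\overline x)$. For $r\subseteq\Sigma\times\Sigma$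 (with $\circ$ denoting left-to-right relational composition), $\mathsf E^{\mathsf{first}}_x r=\mathrm{id}(\overline x)\circ r$, $\mathsf E^{\mathsf{last}}_x r=r\circ\mathrm{id}(\overline x)$, $\mathsf E_x r=\mathrm{id}(\overline x)\circ r\circ\mathrm{id}(\overline x)$. $\overline r$ is the complement of $r$. A relation $g$ is reflexive if $\mathrm{id}\subseteq g$. Primitive commands. $\tau:\mathcal P(\Sigma)\to\mathcal C$ (tests) and $\pi,\epsilon:\mathcal P(\Sigma\times\Sigma)\to\mathcal A$ (program and environment steps) are injective homomorphisms of complete Boolean algebras onto complete Boolean sub-algebras of $\mathcal C$ (joins, and nonempty meets, computed in $\mathcal C$; complement relative to the greatest element of the sub-algebra), with $\tau(\emptyset)=\pi(\emptyset)=\epsilon(\emptyset)=\bot$ and $\tau(\Sigma)=\mathbf{nil}$. $\mathcal A\subseteq\mathcal C$ is the complete Boolean sub-algebra of atomic steps, in which $\boldsymbol\pi=\pi(\Sigma\times\Sigma)$ and $\boldsymbol\epsilon=\epsilon(\Sigma\times\Sigma)$ are complementary; $\boldsymbol\alpha=\boldsymbol\pi\sqcup\boldsymbol\epsilon$. $\mathbf{chaos}=\boldsymbol\alpha^\omega$ is the identity of $\Cap$, and $a=a\Cap(\boldsymbol\alpha;\mathbf{chaos})$ for all $a\in\mathcal A$. Localisation. For each $x\in V$ there are unary operators $\mathsf E_x,\mathsf E^{\mathsf{first}}_x,\mathsf E^{\mathsf{last}}_x$ on $\mathcal C$ (binding tighter than binary operators). Each family $F\in\{\mathsf E,\mathsf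 E^{\mathsf{first}},\mathsf E^{\mathsf{last}}\}$ satisfies $c\le F_xc$; $F_x(c\sqcap F_xd)=F_xc\sqcap F_xd$; $F_xF_yc=F_yF_xc$; $F_x(\bigsqcup C)=\bigsqcup_{c\in C}F_xc$. Further axioms: $\mathsf E^{\mathsf{first}}_xc\le\mathsf E_xc$; $\mathsf E^{\mathsf{last}}_xc\le\mathsf E_xc$; $\mathsf E_x\mathsf E^{\mathsf{first}}_yc=\mathsf E^{\mathsf{first}}_y\mathsf E_xc$; $\mathsf E_x\mathsf E^{\mathsf{last}}_yc=\mathsf E^{\mathsf{last}}_y\mathsf E_xc$; $\mathsf E^{\mathsf{first}}_x\mathsf E^{\mathsf{last}}_yc=\mathsf E^{\mathsf{last}}_y\mathsf E^{\mathsf{first}}_xc$; $\mathsf E_x\tau(p)=\mathsf E^{\mathsf{first}}_x\tau(p)=\mathsf E^{\mathsf{last}}_x\tau(p)=\tau(\mathsf E_xp)$; $F_x\pi(r)=\pi(F_xr)$ and $F_x\epsilon(r)=\epsilon(F_xr)$ for each of the three $F$; $\mathsf E_x(c;\mathsf E^{\mathsf{first}}_xd)=\mathsf E_xc;\mathsf E_xd=\mathsf E_x(\mathsf E^{\mathsf{last}}_xc;d)$; if $c=c\Cap(\boldsymbol\alpha;\mathbf{chaos})$ then $\mathsf E^{\mathsf{first}}_x(c;d)=\mathsf E^{\mathsf{first}}_xc;d$ and $\mathsf E^{\mathsf{last}}_x(d;c)=d;\mathsf E^{\mathsf{last}}_xc$; $\mathsf E_x(c\Cap\mathsf E_xd)=\mathsf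 E_xc\Cap\mathsf E_xd$; $\mathsf E^{\mathsf{first}}_x(c\Cap\mathsf E^{\mathsf{first}}_xd)=\mathsf E^{\mathsf{first}}_xc\Cap\mathsf E^{\mathsf{first}}_xd$; for $a\in\mathcal A$ with $\mathsf E_xa=\mathsf E^{\mathsf{last}}_xa$, $\mathsf E_x(a^\infty)=(\mathsf E_xa)^\infty$. Derived commands. $\mathbf{guar}\,g=(\pi(g)\sqcup\boldsymbol\epsilon)^\omega$; $\mathbf{demand}\,r=(\epsilon(r)\sqcup\boldsymbol\pi)^\omega$; $\mathbf{rely}\,r=(\boldsymbol\alpha\sqcup\epsilon(\overline r);\top)^\omega=\boldsymbol\alpha^\omega;(\mathbf{nil}\sqcup\epsilon(\overline r);\top)$; $\mathbf{term}=\boldsymbol\alpha^\star;\boldsymbol\epsilon^\omega$; $\mathbf{idle}=\mathbf{term}\Cap\mathbf{guar}\,\mathrm{id}$. Known properties of the algebra: $\mathbf{guar}\,g_1\Cap\mathbf{guar}\,g_2=\mathbf{guar}(g_1\cap g_2)$; $\mathbf{guar}\,g\Cap(c;d)=(\mathbf{guar}\,g\Cap c);(\mathbf{guar}\,g\Cap d)$; $\mathbf{rely}\,r_1\ge\mathbf{rely}\,r_2$ if $r_1\subseteq r_2$; $\mathbf{rely}\,r\Cap c\ge c$; $\mathbf{rely}\,r_1\Cap\mathbf{rely}\,r_2=\mathbf{rely}(r_1\cap r_2)$; $\mathbf{rely}\,r\Cap(c;d)\ge(\mathbf{rely}\,r\Cap c);(\mathbf{rely}\,r\Cap d)$; $\mathbf{demand}\,r\Cap\mathbf{rely}\,r=\mathbf{demand}\,r$;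 $\mathbf{idle}=\mathbf{idle}\Cap\mathbf{guar}\,g$ if $g$ is reflexive. Local blocks. $(\mathbf{local}\,x\cdot c)=\mathsf E_x(\mathbf{demand}\,\mathrm{id}(x)\Cap c)\Cap\mathbf{guar}\,\mathrm{id}(x)$ and $(\mathbf{var}\,x\cdot c)=\mathbf{idle};(\mathbf{local}\,x\cdot c);\mathbf{idle}$. *)

theory Defs
  imports "HOL-Library.Countable_Set"
begin

unbundle lattice_syntax

section \<open>Commands\<close>

class command = complete_lattice + distrib_lattice +
  fixes seq :: "'a \<Rightarrow> 'a \<Rightarrow> 'a"  (infixr \<open>\<Zsemi>\<close> 75)
    and nil :: 'a
    and conj :: "'a \<Rightarrow> 'a \<Rightarrow> 'a"  (infixl \<open>\<inter>\<^sub>w\<close> 72)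
  assumes seq_assoc: "(a \<Zsemi> b) \<Zsemi> c = a \<Zsemi> (b \<Zsemi> c)"
    and nil_seq: "nil \<Zsemi> c = c"
    and seq_nil: "c \<Zsemi> nil = c"
    and seq_mono: "\<lbrakk> a \<le> b; c \<le> d \<rbrakk> \<Longrightarrow> a \<Zsemi> c \<le> b \<Zsemi> d"
    and conj_assoc: "(a \<inter>\<^sub>w b) \<inter>\<^sub>w c = a \<inter>\<^sub>w (b \<inter>\<^sub>w c)"
    and conj_commute: "a \<inter>\<^sub>w b = b \<inter>\<^sub>w a"
    and conj_idem: "c \<inter>\<^sub>w c = c"
    and conj_mono: "\<lbrakk> a \<le> b; c \<le> d \<rbrakk> \<Longrightarrow> a \<inter>\<^sub>w c \<le> b \<inter>\<^sub>w d"

primrec seq_power :: "'c::command \<Rightarrow> nat \<Rightarrow> 'c" where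
  "seq_power c 0 = nil"
| "seq_power c (Suc i) = c \<Zsemi> seq_power c i"

definition fin_iter :: "'c::command \<Rightarrow> 'c"  (\<open>_\<^sup>\<star>\<close> [1000] 999) where
  "c\<^sup>\<star> = lfp (\<lambda>y. nil \<squnion> c \<Zsemi> y)"

definition omega_iter :: "'c::command \<Rightarrow> 'c"  (\<open>_\<^sup>\<omega>\<close> [1000] 999) where
  "c\<^sup>\<omega> = gfp (\<lambda>y. nil \<squnion> c \<Zsemi> y)"

definition inf_iter :: "'c::command \<Rightarrow> 'c"  (\<open>_\<^sup>\<infinity>\<close> [1000] 999) where
  "c\<^sup>\<infinity> = c\<^sup>\<omega> \<Zsemi> \<bottom>"


section \<open>Complete Boolean sub-algebras and their embeddings\<close>

text \<open>Complements are relative to the greatest element \<open>\<Squnion>B\<close> of the sub-algebra, which need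
  not be \<open>\<top>\<close>.  The least element is \<open>\<bottom> = \<Squnion>{}\<close>; the empty meet is excluded, because computed in
  the ambient lattice it is \<open>\<top>\<close>.\<close>

definition rel_complement :: "'c::complete_lattice set \<Rightarrow> 'c \<Rightarrow> 'c \<Rightarrow> bool" where
  "rel_complement B a b \<longleftrightarrow> a \<sqinter> b = \<bottom> \<and> a \<squnion> b = \<Squnion>B"

definition complete_boolean_subalgebra :: "'c::complete_lattice set \<Rightarrow> bool" where
  "complete_boolean_subalgebra B \<longleftrightarrow>
     (\<forall>X \<subseteq> B. \<Squnion>X \<in> B) \<and>
     (\<forall>X \<subseteq> B. X \<noteq> {} \<longrightarrow> \<Sqinter>X \<in> B) \<and>
     (\<forall>a \<in> B. \<exists>b \<in> B. rel_complement B a b)"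

definition boolean_embedding :: "'u set \<Rightarrow> ('u set \<Rightarrow> 'c::complete_lattice) \<Rightarrow> bool" where
  "boolean_embedding U h \<longleftrightarrow>
     inj_on h (Pow U) \<and>
     complete_boolean_subalgebra (h ` Pow U) \<and>
     (\<forall>P \<subseteq> Pow U. h (\<Union>P) = \<Squnion>(h ` P)) \<and>
     (\<forall>P \<subseteq> Pow U. P \<noteq> {} \<longrightarrow> h (\<Inter>P) = \<Sqinter>(h ` P)) \<and>
     (\<forall>p \<subseteq> U. rel_complement (h ` Pow U) (h p) (h (U - p)))"


section \<open>Signature, states and relations\<close>

record ('v, 's, 'c) rg_algebra =
  vars :: "'v set"
  vals :: "'s set"
  test :: "('v \<rightharpoonup> 's) set \<Rightarrow> 'c"
  pgm :: "('v \<rightharpoonup> 's) rel \<Rightarrow> 'c"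
  env :: "('v \<rightharpoonup> 's) rel \<Rightarrow> 'c"
  atomic :: "'c set"
  loc :: "'v \<Rightarrow> 'c \<Rightarrow> 'c"
  loc_first :: "'v \<Rightarrow> 'c \<Rightarrow> 'c"
  loc_last :: "'v \<Rightarrow> 'c \<Rightarrow> 'c"

definition states :: "('v, 's, 'c, 'z) rg_algebra_scheme \<Rightarrow> ('v \<rightharpoonup> 's) set" where
  "states M = {\<sigma>. dom \<sigma> \<subseteq> vars M \<and> ran \<sigma> \<subseteq> vals M}"

definition id_on :: "('v, 's, 'c, 'z) rg_algebra_scheme \<Rightarrow> 'v set \<Rightarrow> ('v \<rightharpoonup> 's) rel" where
  "id_on M W = {(\<sigma>, \<sigma>') \<in> states M \<times> states M. \<forall>v \<in> W. \<sigma> v = \<sigma>' v}"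

definition id_except :: "('v, 's, 'c, 'z) rg_algebra_scheme \<Rightarrow> 'v \<Rightarrow> ('v \<rightharpoonup> 's) rel" where
  "id_except M x = id_on M (vars M - {x})"

definition set_loc ::
  "('v, 's, 'c, 'z) rg_algebra_scheme \<Rightarrow> 'v \<Rightarrow> ('v \<rightharpoonup> 's) set \<Rightarrow> ('v \<rightharpoonup> 's) set" where
  "set_loc M x p = id_except M x `` p"

definition rel_loc_first ::
  "('v, 's, 'c, 'z) rg_algebra_scheme \<Rightarrow> 'v \<Rightarrow> ('v \<rightharpoonup> 's) rel \<Rightarrow> ('v \<rightharpoonup> 's) rel" where
  "rel_loc_first M x r = id_except M x O r"

definition rel_loc_last ::
  "('v, 's, 'c, 'z) rg_algebra_scheme \<Rightarrow> 'v \<Rightarrow> ('v \<rightharpoonup> 's) rel \<Rightarrow> ('v \<rightharpoonup> 's) rel" where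
  "rel_loc_last M x r = r O id_except M x"

definition rel_loc ::
  "('v, 's, 'c, 'z) rg_algebra_scheme \<Rightarrow> 'v \<Rightarrow> ('v \<rightharpoonup> 's) rel \<Rightarrow> ('v \<rightharpoonup> 's) rel" where
  "rel_loc M x r = id_except M x O r O id_except M x"


section \<open>Derived commands\<close>

definition pgm_any :: "('v, 's, 'c, 'z) rg_algebra_scheme \<Rightarrow> 'c" where
  "pgm_any M = pgm M (states M \<times> states M)"

definition env_any :: "('v, 's, 'c, 'z) rg_algebra_scheme \<Rightarrow> 'c" where
  "env_any M = env M (states M \<times> states M)"

definition step_any :: "('v, 's, 'c::command, 'z) rg_algebra_scheme \<Rightarrow> 'c" where
  "step_any M = pgm_any M \<squnion> env_any M"

definition chaos :: "('v, 's, 'c::command, 'z) rg_algebra_scheme \<Rightarrow> 'c" where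
  "chaos M = (step_any M)\<^sup>\<omega>"

definition guar :: "('v, 's, 'c::command, 'z) rg_algebra_scheme \<Rightarrow> ('v \<rightharpoonup> 's) rel \<Rightarrow> 'c" where
  "guar M g = (pgm M g \<squnion> env_any M)\<^sup>\<omega>"

definition demand :: "('v, 's, 'c::command, 'z) rg_algebra_scheme \<Rightarrow> ('v \<rightharpoonup> 's) rel \<Rightarrow> 'c" where
  "demand M r = (env M r \<squnion> pgm_any M)\<^sup>\<omega>"

definition rely :: "('v, 's, 'c::command, 'z) rg_algebra_scheme \<Rightarrow> ('v \<rightharpoonup> 's) rel \<Rightarrow> 'c" where
  "rely M r = (step_any M \<squnion> env M (states M \<times> states M - r) \<Zsemi> \<top>)\<^sup>\<omega>"

definition terminating :: "('v, 's, 'c::command, 'z) rg_algebra_scheme \<Rightarrow> 'c" where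
  "terminating M = (step_any M)\<^sup>\<star> \<Zsemi> (env_any M)\<^sup>\<omega>"

definition idle :: "('v, 's, 'c::command, 'z) rg_algebra_scheme \<Rightarrow> 'c" where
  "idle M = terminating M \<inter>\<^sub>w guar M (Id_on (states M))"

definition local_block :: "('v, 's, 'c::command, 'z) rg_algebra_scheme \<Rightarrow> 'v \<Rightarrow> 'c \<Rightarrow> 'c" where
  "local_block M x c = loc M x (demand M (id_on M {x}) \<inter>\<^sub>w c) \<inter>\<^sub>w guar M (id_on M {x})"

definition var_block :: "('v, 's, 'c::command, 'z) rg_algebra_scheme \<Rightarrow> 'v \<Rightarrow> 'c \<Rightarrow> 'c" where
  "var_block M x c = idle M \<Zsemi> local_block M x c \<Zsemi> idle M"


section \<open>The rely/guarantee algebra\<close>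

text \<open>The laws from \<open>fin_iter_eq\<close> to \<open>omega_iter_eq\<close> and from \<open>rely_eq\<close> onwards are properties of
  the underlying concurrent program algebra that the theory of localisation builds on.  They are
  postulated because the remaining laws do not determine them: distribution of \<open>\<Zsemi>\<close> over joins
  and the exchange laws between \<open>\<Zsemi>\<close> and \<open>\<inter>\<^sub>w\<close>, for example, enter only through them.\<close>

locale rg_program_algebra =
  fixes M :: "('v, 's, 'c::command, 'z) rg_algebra_scheme"
  assumes countable_vars: "countable (vars M)"

    and fin_iter_eq: "\<And>c::'c. c\<^sup>\<star> = (\<Squnion>i. seq_power c i)"
    and omega_iter_eq: "\<And>c::'c. c\<^sup>\<omega> = c\<^sup>\<star> \<squnion> c\<^sup>\<infinity>"

    and test_embedding: "boolean_embedding (states M) (test M)"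
    and pgm_embedding: "boolean_embedding (states M \<times> states M) (pgm M)"
    and env_embedding: "boolean_embedding (states M \<times> states M) (env M)"
    and test_empty: "test M {} = \<bottom>"
    and pgm_empty: "pgm M {} = \<bottom>"
    and env_empty: "env M {} = \<bottom>"
    and test_states: "test M (states M) = nil"

    and atomic_subalgebra: "complete_boolean_subalgebra (atomic M)"
    and pgm_atomic: "\<And>r. r \<subseteq> states M \<times> states M \<Longrightarrow> pgm M r \<in> atomic M"
    and env_atomic: "\<And>r. r \<subseteq> states M \<times> states M \<Longrightarrow> env M r \<in> atomic M"
    and pgm_env_complement: "rel_complement (atomic M) (pgm_any M) (env_any M)"
    and chaos_conj: "\<And>c. chaos M \<inter>\<^sub>w c = c"
    and atomic_conj: "\<And>a. a \<in> atomic M \<Longrightarrow> a = a \<inter>\<^sub>w (step_any M \<Zsemi> chaos M)"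

    and rely_eq: "\<And>r. r \<subseteq> states M \<times> states M \<Longrightarrow>
      rely M r = (step_any M)\<^sup>\<omega> \<Zsemi> (nil \<squnion> env M (states M \<times> states M - r) \<Zsemi> \<top>)"
    and guar_conj_guar: "\<And>g1 g2. \<lbrakk> g1 \<subseteq> states M \<times> states M; g2 \<subseteq> states M \<times> states M \<rbrakk> \<Longrightarrow>
      guar M g1 \<inter>\<^sub>w guar M g2 = guar M (g1 \<inter> g2)"
    and guar_conj_seq: "\<And>g c d. g \<subseteq> states M \<times> states M \<Longrightarrow>
      guar M g \<inter>\<^sub>w (c \<Zsemi> d) = (guar M g \<inter>\<^sub>w c) \<Zsemi> (guar M g \<inter>\<^sub>w d)"
    and rely_antimono: "\<And>r1 r2. \<lbrakk> r1 \<subseteq> r2; r2 \<subseteq> states M \<times> states M \<rbrakk> \<Longrightarrow>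
      rely M r1 \<ge> rely M r2"
    and rely_conj_ge: "\<And>r c. r \<subseteq> states M \<times> states M \<Longrightarrow> rely M r \<inter>\<^sub>w c \<ge> c"
    and rely_conj_rely: "\<And>r1 r2. \<lbrakk> r1 \<subseteq> states M \<times> states M; r2 \<subseteq> states M \<times> states M \<rbrakk> \<Longrightarrow>
      rely M r1 \<inter>\<^sub>w rely M r2 = rely M (r1 \<inter> r2)"
    and rely_conj_seq: "\<And>r c d. r \<subseteq> states M \<times> states M \<Longrightarrow>
      rely M r \<inter>\<^sub>w (c \<Zsemi> d) \<ge> (rely M r \<inter>\<^sub>w c) \<Zsemi> (rely M r \<inter>\<^sub>w d)"
    and demand_conj_rely: "\<And>r. r \<subseteq> states M \<times> states M \<Longrightarrow>
      demand M r \<inter>\<^sub>w rely M r = demand M r"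
    and idle_conj_guar: "\<And>g. \<lbrakk> g \<subseteq> states M \<times> states M; Id_on (states M) \<subseteq> g \<rbrakk> \<Longrightarrow>
      idle M = idle M \<inter>\<^sub>w guar M g"


section \<open>Localisation\<close>

definition localisation_family :: "'v set \<Rightarrow> ('v \<Rightarrow> 'c::command \<Rightarrow> 'c) \<Rightarrow> bool" where
  "localisation_family V F \<longleftrightarrow>
     (\<forall>x \<in> V. \<forall>c. c \<le> F x c) \<and>
     (\<forall>x \<in> V. \<forall>c d. F x (c \<sqinter> F x d) = F x c \<sqinter> F x d) \<and>
     (\<forall>x \<in> V. \<forall>y \<in> V. \<forall>c. F x (F y c) = F y (F x c)) \<and>
     (\<forall>x \<in> V. \<forall>C. F x (\<Squnion>C) = (\<Squnion>c \<in> C. F x c))"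

locale localisation_algebra = rg_program_algebra M
  for M :: "('v, 's, 'c::command, 'z) rg_algebra_scheme" +
  assumes loc_family: "localisation_family (vars M) (loc M)"
    and loc_first_family: "localisation_family (vars M) (loc_first M)"
    and loc_last_family: "localisation_family (vars M) (loc_last M)"

    and loc_first_le: "\<And>x c. x \<in> vars M \<Longrightarrow> loc_first M x c \<le> loc M x c"
    and loc_last_le: "\<And>x c. x \<in> vars M \<Longrightarrow> loc_last M x c \<le> loc M x c"
    and loc_loc_first: "\<And>x y c. \<lbrakk> x \<in> vars M; y \<in> vars M \<rbrakk> \<Longrightarrow>
      loc M x (loc_first M y c) = loc_first M y (loc M x c)"
    and loc_loc_last: "\<And>x y c. \<lbrakk> x \<in> vars M; y \<in> vars M \<rbrakk> \<Longrightarrow>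
      loc M x (loc_last M y c) = loc_last M y (loc M x c)"
    and loc_first_loc_last: "\<And>x y c. \<lbrakk> x \<in> vars M; y \<in> vars M \<rbrakk> \<Longrightarrow>
      loc_first M x (loc_last M y c) = loc_last M y (loc_first M x c)"

    and loc_test: "\<And>x p. \<lbrakk> x \<in> vars M; p \<subseteq> states M \<rbrakk> \<Longrightarrow>
      loc M x (test M p) = test M (set_loc M x p)"
    and loc_first_test: "\<And>x p. \<lbrakk> x \<in> vars M; p \<subseteq> states M \<rbrakk> \<Longrightarrow>
      loc_first M x (test M p) = test M (set_loc M x p)"
    and loc_last_test: "\<And>x p. \<lbrakk> x \<in> vars M; p \<subseteq> states M \<rbrakk> \<Longrightarrow>
      loc_last M x (test M p) = test M (set_loc M x p)"

    and loc_pgm: "\<And>x r. \<lbrakk> x \<in> vars M; r \<subseteq> states M \<times> states M \<rbrakk> \<Longrightarrow>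
      loc M x (pgm M r) = pgm M (rel_loc M x r)"
    and loc_first_pgm: "\<And>x r. \<lbrakk> x \<in> vars M; r \<subseteq> states M \<times> states M \<rbrakk> \<Longrightarrow>
      loc_first M x (pgm M r) = pgm M (rel_loc_first M x r)"
    and loc_last_pgm: "\<And>x r. \<lbrakk> x \<in> vars M; r \<subseteq> states M \<times> states M \<rbrakk> \<Longrightarrow>
      loc_last M x (pgm M r) = pgm M (rel_loc_last M x r)"
    and loc_env: "\<And>x r. \<lbrakk> x \<in> vars M; r \<subseteq> states M \<times> states M \<rbrakk> \<Longrightarrow>
      loc M x (env M r) = env M (rel_loc M x r)"
    and loc_first_env: "\<And>x r. \<lbrakk> x \<in> vars M; r \<subseteq> states M \<times> states M \<rbrakk> \<Longrightarrow>
      loc_first M x (env M r) = env M (rel_loc_first M x r)"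
    and loc_last_env: "\<And>x r. \<lbrakk> x \<in> vars M; r \<subseteq> states M \<times> states M \<rbrakk> \<Longrightarrow>
      loc_last M x (env M r) = env M (rel_loc_last M x r)"

    and loc_seq_first: "\<And>x c d. x \<in> vars M \<Longrightarrow>
      loc M x (c \<Zsemi> loc_first M x d) = loc M x c \<Zsemi> loc M x d"
    and loc_seq_last: "\<And>x c d. x \<in> vars M \<Longrightarrow>
      loc M x (loc_last M x c \<Zsemi> d) = loc M x c \<Zsemi> loc M x d"
    and loc_first_seq: "\<And>x c d. \<lbrakk> x \<in> vars M; c = c \<inter>\<^sub>w (step_any M \<Zsemi> chaos M) \<rbrakk> \<Longrightarrow>
      loc_first M x (c \<Zsemi> d) = loc_first M x c \<Zsemi> d"
    and loc_last_seq: "\<And>x c d. \<lbrakk> x \<in> vars M; c = c \<inter>\<^sub>w (step_any M \<Zsemi> chaos M) \<rbrakk> \<Longrightarrow>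
      loc_last M x (d \<Zsemi> c) = d \<Zsemi> loc_last M x c"

    and loc_conj: "\<And>x c d. x \<in> vars M \<Longrightarrow>
      loc M x (c \<inter>\<^sub>w loc M x d) = loc M x c \<inter>\<^sub>w loc M x d"
    and loc_first_conj: "\<And>x c d. x \<in> vars M \<Longrightarrow>
      loc_first M x (c \<inter>\<^sub>w loc_first M x d) = loc_first M x c \<inter>\<^sub>w loc_first M x d"
    and loc_inf_iter: "\<And>x a. \<lbrakk> x \<in> vars M; a \<in> atomic M; loc M x a = loc_last M x a \<rbrakk> \<Longrightarrow>
      loc M x (a\<^sup>\<infinity>) = (loc M x a)\<^sup>\<infinity>"

end

theory Submission
  imports Defs
begin

text \<open>For every relation \<open>g\<close> the command \<open>guar (E\<^sub>x g)\<close> is a fixed point of \<open>E\<^sub>x\<close>: its step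
  command is fixed by \<open>E\<^sub>x\<close> and by the last-state localisation, hence so are its finite iterations,
  and so is the infinite one.  Since \<open>guar g\<close> absorbs the weaker \<open>guar (E\<^sub>x g)\<close>, that guarantee can
  be pulled out of \<open>E\<^sub>x (demand id(x) \<inter>\<^sub>w c \<inter>\<^sub>w guar g)\<close>.  As guarantees distribute over sequential
  composition and \<open>idle\<close> absorbs reflexive ones, the guarantee extends to the whole block.\<close>

lemma conj_left_commute: "a \<inter>\<^sub>w (b \<inter>\<^sub>w c) = b \<inter>\<^sub>w (a \<inter>\<^sub>w c)"
  for a b c :: "'c::command"
  by (metis conj_assoc conj_commute)

lemma rel_loc_subset_states: "rel_loc M x r \<subseteq> states M \<times> states M"
  by (auto simp: rel_loc_def id_except_def id_on_def)

lemma subset_rel_loc: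
  assumes "r \<subseteq> states M \<times> states M"
  shows "r \<subseteq> rel_loc M x r"
proof
  fix p assume "p \<in> r"
  moreover obtain s t where "p = (s, t)" by fastforce
  moreover have "(s, s) \<in> id_except M x" "(t, t) \<in> id_except M x" if "(s, t) \<in> r"
    using that assms by (auto simp: id_except_def id_on_def)
  ultimately show "p \<in> rel_loc M x r"
    unfolding rel_loc_def by blast
qed

text \<open>Equality, not just inclusion: the relation is transitive, and it is reflexive on
  \<open>states M\<close>, where all its pairs lie.\<close>

lemma id_except_trans: "id_except M x O id_except M x = id_except M x"
  by (fastforce simp: id_except_def id_on_def)

lemma rel_loc_rel_loc: "rel_loc M x (rel_loc M x r) = rel_loc M x r"
  proof -
  let ?i = "id_except M x"
  have "rel_loc M x (rel_loc M x r) = (?i O ?i) O r O (?i O ?i)"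
    by (simp only: rel_loc_def O_assoc)
  then show ?thesis by (simp only: id_except_trans rel_loc_def)
qed

text \<open>The trailing \<open>id_except M x\<close> absorbs another copy. This makes steps built
  from \<open>rel_loc M x r\<close> invariant under \<open>loc_last\<close>, as
  \<open>loc_inf_iter\<close> requires.\<close>

lemma rel_loc_last_rel_loc: "rel_loc_last M x (rel_loc M x r) = rel_loc M x r"
  unfolding rel_loc_def rel_loc_last_def by (simp add: O_assoc id_except_trans)

lemma rel_loc_states: "rel_loc M x (states M \<times> states M) = states M \<times> states M"
  by (rule antisym[OF rel_loc_subset_states subset_rel_loc]) simp

lemma set_loc_states: "set_loc M x (states M) = states M"
  by (auto simp: set_loc_def id_except_def id_on_def)

lemma localisation_family_sup:
  assumes "localisation_family V F" "x \<in> V"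
  shows "F x (a \<squnion> b) = F x a \<squnion> F x b"
proof -
  have "F x (\<Squnion>{a, b}) = (\<Squnion>c\<in>{a, b}. F x c)"
    using assms unfolding localisation_family_def by blast
  then show ?thesis by simp
qed

lemma complete_boolean_subalgebra_sup:
  assumes "complete_boolean_subalgebra B" "a \<in> B" "b \<in> B"
  shows "a \<squnion> b \<in> B"
proof -
  have "\<Squnion>{a, b} \<in> B"
    using assms unfolding complete_boolean_subalgebra_def by (meson empty_subsetI insert_subset)
  then show ?thesis by simp
qed

context localisation_algebra
begin

lemma loc_nil:
  assumes "x \<in> vars M"
  shows "loc M x nil = nil"
  using loc_test[OF assms subset_refl] by (simp add: set_loc_states test_states)

lemma loc_seq_power:
  assumes x: "x \<in> vars M" and "loc M x a = a" and last: "loc_last M x a = a"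
  shows "loc M x (seq_power a i) = seq_power a i"
proof (induction i)
  case 0
  show ?case using x by (simp add: loc_nil)
next
  case (Suc i)
  then show ?case
    \<comment> \<open>As \<open>loc_last M x a = a\<close>, the composition already has the form in
      which \<open>loc\<close> distributes over both factors.\<close>
    using loc_seq_last[OF x, of a "seq_power a i"] assms by simp
qed

lemma loc_omega_iter:
  assumes x: "x \<in> vars M" and "a \<in> atomic M" and "loc M x a = a" and "loc_last M x a = a"
  shows "loc M x (a\<^sup>\<omega>) = a\<^sup>\<omega>"
proof -
  \<comment> \<open>The finite iteration is the join of the powers, and \<open>loc\<close> preserves
    arbitrary joins.\<close>
  have "loc M x (a\<^sup>\<star>) = (\<Squnion>c \<in> range (seq_power a). loc M x c)"
    using loc_family x unfolding localisation_family_def fin_iter_eq by blast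
  also have "\<dots> = a\<^sup>\<star>"
    by (simp add: fin_iter_eq image_image loc_seq_power assms)
  finally have "loc M x (a\<^sup>\<star>) = a\<^sup>\<star>" .
  moreover have "loc M x (a\<^sup>\<infinity>) = a\<^sup>\<infinity>"
    using loc_inf_iter[of x a] assms by simp
  ultimately show ?thesis
    by (simp add: omega_iter_eq localisation_family_sup[OF loc_family x])
qed

lemma loc_guar_rel_loc:
  assumes x: "x \<in> vars M"
  shows "loc M x (guar M (rel_loc M x r)) = guar M (rel_loc M x r)"
proof -
  \<comment> \<open>The full relation is its own \<open>rel_loc\<close>, so it is an instance of the
    last-state invariance.\<close>
  have last_states: "rel_loc_last M x (states M \<times> states M) = states M \<times> states M"
    by (metis rel_loc_last_rel_loc rel_loc_states)
  show ?thesis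
    unfolding guar_def
  proof (rule loc_omega_iter[OF x])
    show "pgm M (rel_loc M x r) \<squnion> env_any M \<in> atomic M"
      unfolding env_any_def
      by (intro complete_boolean_subalgebra_sup atomic_subalgebra pgm_atomic env_atomic
          rel_loc_subset_states subset_refl)
    show "loc M x (pgm M (rel_loc M x r) \<squnion> env_any M) = pgm M (rel_loc M x r) \<squnion> env_any M"
      by (simp add: env_any_def localisation_family_sup[OF loc_family x] loc_pgm[OF x] loc_env[OF x]
          rel_loc_subset_states rel_loc_rel_loc rel_loc_states)
    show "loc_last M x (pgm M (rel_loc M x r) \<squnion> env_any M) = pgm M (rel_loc M x r) \<squnion> env_any M"
      by (simp add: env_any_def localisation_family_sup[OF loc_last_family x] loc_last_pgm[OF x]
          loc_last_env[OF x] rel_loc_subset_states rel_loc_last_rel_loc last_states)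
  qed
qed

lemma loc_conj_guar:
  assumes x: "x \<in> vars M" and g: "g \<subseteq> states M \<times> states M"
  shows "loc M x (c \<inter>\<^sub>w guar M g) = loc M x (c \<inter>\<^sub>w guar M g) \<inter>\<^sub>w guar M (rel_loc M x g)"
proof -
  have "guar M g \<inter>\<^sub>w guar M (rel_loc M x g) = guar M g"
    using subset_rel_loc[OF g] g by (simp add: guar_conj_guar rel_loc_subset_states Int_absorb2)
  then have "loc M x (c \<inter>\<^sub>w guar M g) = loc M x ((c \<inter>\<^sub>w guar M g) \<inter>\<^sub>w guar M (rel_loc M x g))"
    by (simp add: conj_assoc)
  then show ?thesis
    \<comment> \<open>\<open>loc_conj\<close> needs a localised second operand; the weaker guarantee
      qualifies because it is fixed by \<open>loc\<close>.\<close>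
    using loc_conj[OF x, of "c \<inter>\<^sub>w guar M g" "guar M (rel_loc M x g)"]
    by (simp add: loc_guar_rel_loc[OF x])
qed

text \<open>The two guarantees have different sources: \<open>rel_loc M x g\<close> comes out of the
  localised body, \<open>id_on M {x}\<close> from the definition of the block. The new guarantee
  stands on the left to match the result of \<open>guar_conj_seq\<close>.\<close>

lemma local_block_conj_guar:
  assumes x: "x \<in> vars M" and g: "g \<subseteq> states M \<times> states M"
  shows "local_block M x (c \<inter>\<^sub>w guar M g)
    = guar M (rel_loc M x g \<inter> id_on M {x}) \<inter>\<^sub>w local_block M x (c \<inter>\<^sub>w guar M g)"
proof -
  let ?L = "loc M x ((demand M (id_on M {x}) \<inter>\<^sub>w c) \<inter>\<^sub>w guar M g)"
  let ?G = "guar M (rel_loc M x g)" and ?I = "guar M (id_on M {x})"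
  have GI: "guar M (rel_loc M x g \<inter> id_on M {x}) = ?G \<inter>\<^sub>w ?I"
    by (subst guar_conj_guar) (auto simp: rel_loc_subset_states id_on_def)
  have L: "?L = ?L \<inter>\<^sub>w ?G" by (rule loc_conj_guar[OF x g])
  \<comment> \<open>Idempotence supplies a second copy of \<open>?I\<close>, which pairs with
    \<open>?G\<close> while the first stays in the block.\<close>
  have "?L \<inter>\<^sub>w ?I = (?L \<inter>\<^sub>w ?G) \<inter>\<^sub>w (?I \<inter>\<^sub>w ?I)"
    by (simp only: L[symmetric] conj_idem)
  also have "\<dots> = (?G \<inter>\<^sub>w ?I) \<inter>\<^sub>w (?L \<inter>\<^sub>w ?I)"
    by (simp only: conj_assoc conj_commute conj_left_commute)
  finally show ?thesis
    by (simp add: local_block_def GI conj_assoc)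
qed

lemma var_block_conj_guar:
  assumes x: "x \<in> vars M" and g: "g \<subseteq> states M \<times> states M" and refl: "Id_on (states M) \<subseteq> g"
  shows "var_block M x (c \<inter>\<^sub>w guar M g)
    = var_block M x (c \<inter>\<^sub>w guar M g) \<inter>\<^sub>w guar M (rel_loc M x g \<inter> id_on M {x})"
proof -
  let ?h = "rel_loc M x g \<inter> id_on M {x}"
  have h: "?h \<subseteq> states M \<times> states M"
    by (rule le_infI1[OF rel_loc_subset_states])
  have "Id_on (states M) \<subseteq> id_on M {x}"
    by (auto simp: id_on_def)
  then have "Id_on (states M) \<subseteq> ?h"
    using refl subset_rel_loc[OF g, of x] by blast
  then have "guar M ?h \<inter>\<^sub>w idle M = idle M"
    using idle_conj_guar[OF h] by (simp add: conj_commute)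
  then have "guar M ?h \<inter>\<^sub>w var_block M x (c \<inter>\<^sub>w guar M g) = var_block M x (c \<inter>\<^sub>w guar M g)"
    unfolding var_block_def
    \<comment> \<open>The guarantee is distributed over both compositions, and each of the three
      components absorbs its copy.\<close>
    by (simp only: guar_conj_seq[OF h] local_block_conj_guar[OF x g, symmetric])
  then show ?thesis by (simp add: conj_commute)
qed

end

theorem mainTheorem1:
  fixes M :: "('v, 's, 'c::command) rg_algebra" and x :: 'v and c :: 'c and g :: "('v \<rightharpoonup> 's) rel"
  assumes "localisation_algebra M"
    and "x \<in> vars M"
    and "g \<subseteq> states M \<times> states M"
    and "Id_on (states M) \<subseteq> g"
  shows "var_block M x (c \<inter>\<^sub>w guar M g)
       = var_block M x (c \<inter>\<^sub>w guar M g) \<inter>\<^sub>w guar M (rel_loc M x g \<inter> id_on M {x})"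
  using assms by (rule localisation_algebra.var_block_conj_guar)

end
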